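(* Let $A=M-N$ be a weak proper splitting of the first type of $A\in\mathbb{R}^{m\times n}$ with $A^\dagger N\ge 0$. For $\lambda>0$, let $B_\lambda=A^TA+\lambda I$ and let $B_\lambda=M_\lambda-N_\lambda$ be a weak splitting of the second type of $B_\lambda\in\mathbb{R}^{n\times n}$ with $\lim_{\lambda\to 0}N_\lambda B_\lambda^{-1}\ge 0$. If $\lim_{\lambda\to 0}N_\lambda M_\lambda^{-1}\le M^\dagger N$, then $$\lim_{\lambda\to 0}\rho(M_\lambda^{-1}N_\lambda)\le\rho(M^\dagger N)<1.$$
   Context: Matrix inequalities are entrywise. $X^\dagger$ is the Moore-Penrose inverse, $\rho$ the spectral radius. A decomposition $A=M-N$ of $A\in\mathbb{R}^{m\times n}$ is a proper splitting if $A$ and $M$ have the same range and the same null space; it is a weak proper splitting of the first type if moreover $M^\dagger N\ge 0$. For nonsingular $B\in\mathbb{R}^{n\times n}$, a decomposition $B=U-V$ with $U$ nonsingular is a weak splitting of the second type if $VU^{-1}\ge 0$. $\lim_{\lambda\to0}$ denotes the limit as $\lambda\to 0$ through positive values (entrywise for matrices). *)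

theory Defs
  imports "HOL-Analysis.Analysis"
begin

text \<open>
  A real m-by-n matrix is an element of \<open>real ^ 'n ^ 'm\<close>. The library order \<open>\<le>\<close> and the library
  topology on this type are entrywise. The identity matrix is \<open>mat 1\<close>; the numeral \<open>1\<close> would be
  the all-ones matrix.
\<close>

definition is_moore_penrose :: "real ^ 'n ^ 'm \<Rightarrow> real ^ 'm ^ 'n \<Rightarrow> bool" where
  "is_moore_penrose A X \<longleftrightarrow>
     A ** X ** A = A \<and> X ** A ** X = X \<and>
     transpose (A ** X) = A ** X \<and> transpose (X ** A) = X ** A"

definition moore_penrose :: "real ^ 'n ^ 'm \<Rightarrow> real ^ 'm ^ 'n" where
  "moore_penrose A = (THE X. is_moore_penrose A X)"

lemma is_moore_penrose_unique:
  assumes "is_moore_penrose A X" "is_moore_penrose A Y"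
  shows "X = Y"
proof -
  have X: "A ** X ** A = A" "X ** A ** X = X" "transpose (A ** X) = A ** X" "transpose (X ** A) = X ** A"
    and Y: "A ** Y ** A = A" "Y ** A ** Y = Y" "transpose (A ** Y) = A ** Y" "transpose (Y ** A) = Y ** A"
    using assms by (auto simp: is_moore_penrose_def)
  have 1: "A ** X = A ** Y"
  proof -
    have "A ** X = transpose (A ** Y ** A ** X)" using X Y by simp
    also have "\<dots> = transpose (A ** X) ** transpose (A ** Y)"
      by (simp add: matrix_transpose_mul[symmetric] matrix_mul_assoc)
    also have "\<dots> = (A ** X ** A) ** Y" using X Y by (simp add: matrix_mul_assoc)
    finally show ?thesis using X by simp
  qed
  have 2: "X ** A = Y ** A"
  proof -
    have "X ** A = transpose (X ** (A ** Y ** A))" using X Y by simp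
    also have "\<dots> = transpose (Y ** A) ** transpose (X ** A)"
      by (simp add: matrix_transpose_mul[symmetric] matrix_mul_assoc)
    also have "\<dots> = Y ** A ** (X ** A)" by (simp only: X Y)
    also have "\<dots> = Y ** (A ** X ** A)" by (simp only: matrix_mul_assoc)
    finally show ?thesis unfolding X .
  qed
  have "X = X ** (A ** X)" using X by (simp add: matrix_mul_assoc)
  also have "\<dots> = Y ** A ** Y" by (simp add: 1) (simp add: 2 matrix_mul_assoc)
  finally show ?thesis using Y by simp
qed

lemma is_moore_penrose_exists:
  fixes A :: "real ^ 'n ^ 'm"
  shows "\<exists>X. is_moore_penrose A X"
proof -
  note [simp del] = transpose_matrix_vector
  let ?R = "range ((*v) A)" and ?T = "range ((*v) (transpose A))"
  have sR: "span ?R = ?R" and sT: "span ?T = ?T"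
    by (simp_all only: span_eq_iff linear_subspace_image[OF matrix_vector_mul_linear subspace_UNIV])
  have adj: "(A *v x) \<bullet> y = x \<bullet> (transpose A *v y)" for x y
    by (metis dot_lmul_matrix inner_commute transpose_matrix_vector)
  have ker: "A *v k = 0" if "\<And>w. w \<in> ?T \<Longrightarrow> k \<bullet> w = 0" for k
    using that[of "transpose A *v (A *v k)"] adj[of k "A *v k"] by simp
  have inj: "x = 0" if xT: "x \<in> ?T" and x0: "A *v x = 0" for x
  proof -
    obtain w where w: "x = transpose A *v w" using xT by blast
    have "x \<bullet> x = (A *v x) \<bullet> w" using adj[of x w] w by simp
    then show ?thesis using x0 by simp
  qed
  have ex: "\<exists>x. x \<in> ?T \<and> (\<forall>u. (A *v x - y) \<bullet> (A *v u) = 0)" for y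
  proof -
    obtain p z where p: "p \<in> span ?R" "\<And>w. w \<in> span ?R \<Longrightarrow> orthogonal z w" "y = p + z"
      using orthogonal_subspace_decomp_exists[of ?R y] by metis
    obtain x0 where x0: "p = A *v x0" using p sR by auto
    obtain t k where t: "t \<in> span ?T" "\<And>w. w \<in> span ?T \<Longrightarrow> orthogonal k w" "x0 = t + k"
      using orthogonal_subspace_decomp_exists[of ?T x0] by metis
    have "A *v k = 0" using t sT by (intro ker) (metis orthogonal_def)
    then have "A *v t = p" using x0 t by (simp add: matrix_vector_right_distrib)
    moreover have "z \<bullet> (A *v u) = 0" for u using p(2)[of "A *v u"] sR by (auto simp: orthogonal_def)
    ultimately show ?thesis using t sT p by (intro exI[of _ t]) auto
  qed
  then obtain g where g: "\<And>y. g y \<in> ?T" "\<And>y u. (A *v g y - y) \<bullet> (A *v u) = 0"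
    by metis
  have uniq: "x = g y" if "x \<in> ?T" "\<And>u. (A *v x - y) \<bullet> (A *v u) = 0" for x y
  proof -
    have "(A *v (x - g y)) \<bullet> (A *v u) = 0" for u
      using that(2)[of u] g(2)[of y u] by (simp add: matrix_vector_mult_diff_distrib inner_diff_left)
    then have "A *v (x - g y) = 0" by (metis inner_eq_zero_iff)
    moreover have "x - g y \<in> ?T" using that(1) g(1)[of y] sT by (metis span_diff)
    ultimately show ?thesis using inj by fastforce
  qed
  have lin: "linear g"
  proof (rule linearI)
    show "g (a + b) = g a + g b" for a b
      using g(1)[of a] g(1)[of b] g(2)[of a] g(2)[of b] sT
      by (intro uniq[symmetric])
        (metis span_add, simp add: matrix_vector_right_distrib inner_diff_left inner_add_left)
    show "g (c *\<^sub>R a) = c *\<^sub>R g a" for c a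
      using g(1)[of a] g(2)[of a] sT
      by (intro uniq[symmetric])
        (metis span_scale, simp add: matrix_vector_mult_scaleR inner_diff_left)
  qed
  define X where "X = matrix g"
  have X: "X *v y = g y" for y using lin by (simp add: X_def matrix_works linear_matrix_vector_mul_eq)
  have sym: "transpose P = P" if "\<And>x y. (P *v x) \<bullet> y = x \<bullet> (P *v y)" for P :: "real ^ 'k ^ 'k"
  proof -
    have "(transpose P *v x) \<bullet> y = (P *v x) \<bullet> y" for x y
      using that by (metis dot_lmul_matrix transpose_matrix_vector)
    then have "transpose P *v x = P *v x" for x
      by (metis vector_eq_rdot)
    then show ?thesis by (simp add: matrix_eq)
  qed
  have AXA: "A *v g (A *v x) = A *v x" for x
    using g(2)[of "A *v x" "g (A *v x) - x"]
    by (simp add: matrix_vector_mult_diff_distrib)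
  have XAX: "g (A *v g y) = g y" for y
    by (rule uniq[symmetric]) (use g in auto)
  have s1: "(A *v g x) \<bullet> y = x \<bullet> (A *v g y)" for x y
    using g(2)[of x "g y"] g(2)[of y "g x"] inner_commute[of "A *v g x" "A *v g y"]
      inner_commute[of y "A *v g x"]
    by (simp add: inner_diff_left)
  have k0: "(g (A *v x) - x) \<bullet> w = 0" if "w \<in> ?T" for x w
    using that adj[of "g (A *v x) - x"] AXA by (auto simp: matrix_vector_mult_diff_distrib)
  have s2: "g (A *v x) \<bullet> y = x \<bullet> g (A *v y)" for x y
    using k0[OF g(1), of x "A *v y"] k0[OF g(1), of y "A *v x"]
      inner_commute[of "g (A *v x)" "g (A *v y)"] inner_commute[of y "g (A *v x)"]
    by (simp add: inner_diff_left)
  have "is_moore_penrose A X"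
    unfolding is_moore_penrose_def
  proof (intro conjI)
    show "A ** X ** A = A" "X ** A ** X = X"
      by (simp_all add: matrix_eq matrix_vector_mul_assoc[symmetric] X AXA XAX)
    show "transpose (A ** X) = A ** X" "transpose (X ** A) = X ** A"
      by (rule sym, simp add: matrix_vector_mul_assoc[symmetric] X s1 s2)+
  qed
  then show ?thesis by blast
qed

lemma is_moore_penrose_moore_penrose: "is_moore_penrose A (moore_penrose A)"
  unfolding moore_penrose_def
  by (rule theI') (use is_moore_penrose_exists is_moore_penrose_unique in blast)

text \<open>Eigenvalues of a real matrix are taken over the complex numbers.\<close>

definition eigenvalues :: "real ^ 'n ^ 'n \<Rightarrow> complex set" where
  "eigenvalues A = {z. \<exists>v. v \<noteq> 0 \<and> map_matrix complex_of_real A *v v = z *s v}"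

definition spec_radius :: "real ^ 'n ^ 'n \<Rightarrow> real" where
  "spec_radius A = Max (cmod ` eigenvalues A)"

definition proper_splitting :: "real ^ 'n ^ 'm \<Rightarrow> real ^ 'n ^ 'm \<Rightarrow> real ^ 'n ^ 'm \<Rightarrow> bool" where
  "proper_splitting A M N \<longleftrightarrow>
     A = M - N \<and> range ((*v) A) = range ((*v) M) \<and> {x. A *v x = 0} = {x. M *v x = 0}"

definition weak_proper_splitting_first ::
    "real ^ 'n ^ 'm \<Rightarrow> real ^ 'n ^ 'm \<Rightarrow> real ^ 'n ^ 'm \<Rightarrow> bool" where
  "weak_proper_splitting_first A M N \<longleftrightarrow> proper_splitting A M N \<and> 0 \<le> moore_penrose M ** N"

text \<open>
  This notion is used for nonsingular \<open>B\<close> only; nonsingularity is not part of the definition.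
\<close>

definition weak_splitting_second ::
    "real ^ 'n ^ 'n \<Rightarrow> real ^ 'n ^ 'n \<Rightarrow> real ^ 'n ^ 'n \<Rightarrow> bool" where
  "weak_splitting_second B U V \<longleftrightarrow> B = U - V \<and> invertible U \<and> 0 \<le> V ** matrix_inv U"

definition regularized_gram :: "real ^ 'n ^ 'm \<Rightarrow> real \<Rightarrow> real ^ 'n ^ 'n" where
  "regularized_gram A l = transpose A ** A + l *\<^sub>R mat 1"

end

theory Submission
  imports Defs "HOL-Computational_Algebra.Fundamental_Theorem_Algebra"
begin

text \<open>
  The matrices \<open>M'\<^sup>-\<^sup>1 N'\<close> and \<open>N' M'\<^sup>-\<^sup>1\<close> are similar and the latter tend to \<open>L\<close>, so by
  continuity of the spectral radius the limit is \<open>\<rho>(L)\<close>. Being a limit of nonnegative matrices,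
  \<open>L\<close> satisfies \<open>0 \<le> L \<le> W\<close> with \<open>W = M\<^sup>\<dagger> N\<close>, and \<open>\<rho>(L) \<le> \<rho>(W)\<close> by Perron--Frobenius
  monotonicity. Finally \<open>G = A\<^sup>\<dagger> N \<ge> 0\<close> satisfies \<open>G = W + W G\<close>; if \<open>W u \<ge> u\<close> for some nonzero
  \<open>u \<ge> 0\<close>, iterating this identity gives \<open>G u \<ge> k u\<close> for every \<open>k\<close>, which is absurd, so \<open>\<rho>(W) < 1\<close>.
\<close>

section \<open>The characteristic polynomial and the spectrum\<close>

text \<open>The determinant is taken over the ring of complex polynomials, so degree, leading
  coefficient and factorisation are available.\<close>

definition char_polynomial :: "real ^ 'n ^ 'n \<Rightarrow> complex poly" where
  "char_polynomial X = det (mat [:0, 1:] - map_matrix (\<lambda>x. [:complex_of_real x:]) X)"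

lemma poly_det: "poly (det P) z = det (map_matrix (\<lambda>p. poly p z) P)"
  by (simp add: det_def poly_sum poly_prod)

lemma poly_char_polynomial:
  "poly (char_polynomial X) z = det (mat z - map_matrix complex_of_real X)"
  unfolding char_polynomial_def poly_det
  by (rule arg_cong[where f = det]) (simp add: vec_eq_iff mat_def)

lemma mat_mult_vector: "mat z *v v = z *s (v :: 'a::comm_ring_1 ^ 'n)"
  by (simp add: vec_eq_iff matrix_vector_mult_def mat_def if_distrib if_distribR cong: if_cong)

lemma eigenvalues_eq_roots: "eigenvalues X = {z. poly (char_polynomial X) z = 0}"
proof -
  have "z \<in> eigenvalues X \<longleftrightarrow> (\<exists>v. v \<noteq> 0 \<and> (mat z - map_matrix complex_of_real X) *v v = 0)" for z
    unfolding eigenvalues_def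
    by (auto simp: matrix_vector_mult_diff_rdistrib mat_mult_vector)
  moreover have "(\<exists>v. v \<noteq> 0 \<and> B *v v = 0) \<longleftrightarrow> det B = 0" for B :: "complex ^ 'a ^ 'a"
    using matrix_left_invertible_ker[of B] invertible_det_nz[of B] invertible_left_inverse[of B] by blast
  ultimately show ?thesis by (auto simp: poly_char_polynomial)
qed

text \<open>In the Leibniz expansion only diagonal entries have degree 1. The identity permutation
  contributes a monic term of full degree; every other permutation moves some index and loses
  degree.\<close>

lemma
  fixes X :: "real ^ 'n ^ 'n"
  shows degree_char_polynomial: "degree (char_polynomial X) = CARD('n)"
    and lead_coeff_char_polynomial: "lead_coeff (char_polynomial X) = 1"
proof -
  define P where "P = mat [:0, 1:] - map_matrix (\<lambda>x. [:complex_of_real x:]) X"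
  define T where "T p = of_int (sign p) * (\<Prod>i\<in>UNIV. P $ i $ p i)" for p
  have diag: "P $ i $ i = [:- complex_of_real (X $ i $ i), 1:]" for i
    by (simp add: P_def mat_def)
  have offdiag: "degree (P $ i $ j) = (if i = j then 1 else 0)" for i j
    by (auto simp: P_def mat_def)
  have T_id: "degree (T id) = CARD('n)" "lead_coeff (T id) = 1"
    unfolding T_def lead_coeff_mult lead_coeff_prod
    by (simp_all add: sign_id diag degree_prod_sum_eq lead_coeff_prod)
  have deg_T: "degree (T p) < CARD('n)" if p: "p \<noteq> id" for p :: "'n \<Rightarrow> 'n"
  proof -
    obtain k where k: "k \<noteq> p k" using p by (metis eq_id_iff)
    have "degree (T p) \<le> degree (\<Prod>i\<in>UNIV. P $ i $ p i)"
      unfolding T_def by (cases "sign p = 1") (auto simp: sign_def)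
    also have "\<dots> \<le> (\<Sum>i\<in>UNIV. if i = p i then 1 else 0)"
      using degree_prod_sum_le[of UNIV "\<lambda>i. P $ i $ p i"] by (simp add: offdiag o_def)
    also have "\<dots> < (\<Sum>i\<in>(UNIV :: 'n set). 1)"
      by (rule sum_strict_mono_ex1) (use k in auto)
    finally show ?thesis by simp
  qed
  have fin: "finite {p. p permutes (UNIV :: 'n set)}" by (simp add: finite_permutations)
  have "det P = sum T {p. p permutes UNIV}" by (simp add: det_def T_def)
  also have "\<dots> = sum T ({p. p permutes UNIV} - {id}) + T id"
    by (subst sum.remove[OF fin, of id]) (auto simp: permutes_id)
  finally have det: "det P = sum T ({p. p permutes UNIV} - {id}) + T id" .
  have "degree (sum T ({p. p permutes UNIV} - {id})) < degree (T id)"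
    unfolding T_id by (rule degree_sum_less) (auto intro: deg_T)
  note add = degree_add_eq_right[OF this] lead_coeff_add_le[OF this]
  have "degree (det P) = CARD('n)" "lead_coeff (det P) = 1"
    unfolding det using add T_id by simp_all
  then show "degree (char_polynomial X) = CARD('n)" "lead_coeff (char_polynomial X) = 1"
    by (simp_all add: char_polynomial_def P_def)
qed

lemma finite_eigenvalues: "finite (eigenvalues X)"
  unfolding eigenvalues_eq_roots
  by (rule poly_roots_finite) (use lead_coeff_char_polynomial[of X] in force)

lemma eigenvalues_nonempty: "eigenvalues X \<noteq> {}"
  using fundamental_theorem_of_algebra[of "char_polynomial X"] degree_char_polynomial[of X]
  by (auto simp: eigenvalues_eq_roots constant_degree)

lemma cmod_le_spec_radius: "z \<in> eigenvalues X \<Longrightarrow> cmod z \<le> spec_radius X"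
  unfolding spec_radius_def by (simp add: finite_eigenvalues)

lemma spec_radius_attained: obtains z where "z \<in> eigenvalues X" "cmod z = spec_radius X"
proof -
  have "spec_radius X \<in> cmod ` eigenvalues X"
    unfolding spec_radius_def
    by (rule Max_in) (simp_all add: finite_eigenvalues eigenvalues_nonempty)
  then show thesis using that by auto
qed

lemma eigenvalues_transpose: "eigenvalues (transpose X) = eigenvalues X"
proof -
  have "mat z - map_matrix complex_of_real (transpose X)
      = transpose (mat z - map_matrix complex_of_real X)" for z
    by (simp add: vec_eq_iff transpose_def mat_def)
  then show ?thesis by (simp add: eigenvalues_eq_roots poly_char_polynomial det_transpose)
qed

section \<open>Spectra of similar matrices\<close>

lemma map_matrix_of_real_mult:
  "map_matrix complex_of_real (X ** Y) = map_matrix complex_of_real X ** map_matrix complex_of_real Y"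
  by (simp add: vec_eq_iff matrix_matrix_mult_def)

text \<open>\<open>P\<close> carries an eigenvector of \<open>Y\<close> to one of \<open>X\<close>
  for the same eigenvalue; the left inverse \<open>Q\<close> keeps its image nonzero.\<close>

lemma eigenvalues_intertwine:
  fixes X Y P Q :: "real ^ 'n ^ 'n"
  assumes XP: "X ** P = P ** Y" and QP: "Q ** P = mat 1"
  shows "eigenvalues Y \<subseteq> eigenvalues X"
proof
  fix z assume "z \<in> eigenvalues Y"
  then obtain v where v: "v \<noteq> 0" "map_matrix complex_of_real Y *v v = z *s v"
    unfolding eigenvalues_def by blast
  let ?c = "map_matrix complex_of_real"
  have "?c Q *v (?c P *v v) = ?c (mat 1) *v v"
    by (simp add: matrix_vector_mul_assoc flip: QP map_matrix_of_real_mult)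
  also have "?c (mat 1) = mat 1" by (simp add: vec_eq_iff mat_def)
  finally have "?c P *v v \<noteq> 0" using v(1) by auto
  moreover have "?c X *v (?c P *v v) = ?c P *v (?c Y *v v)"
    by (simp add: matrix_vector_mul_assoc XP flip: map_matrix_of_real_mult)
  then have "?c X *v (?c P *v v) = z *s (?c P *v v)"
    by (simp add: v(2) vector_scalar_commute)
  ultimately show "z \<in> eigenvalues X" unfolding eigenvalues_def by blast
qed

lemma spec_radius_matrix_inv_commute:
  fixes U V :: "real ^ 'n ^ 'n"
  assumes "invertible U"
  shows "spec_radius (matrix_inv U ** V) = spec_radius (V ** matrix_inv U)"
proof -
  have U: "U ** matrix_inv U = mat 1" "matrix_inv U ** U = mat 1"
    using someI_ex[OF assms[unfolded invertible_def]] unfolding matrix_inv_def by auto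
  have "eigenvalues (matrix_inv U ** V) = eigenvalues (V ** matrix_inv U)"
    using eigenvalues_intertwine[of "V ** matrix_inv U" U "matrix_inv U ** V" "matrix_inv U"]
      eigenvalues_intertwine[of "matrix_inv U ** V" "matrix_inv U" "V ** matrix_inv U" U]
    by (simp add: U matrix_mul_assoc) (simp add: U flip: matrix_mul_assoc)
  then show ?thesis by (simp add: spec_radius_def)
qed

section \<open>Continuity of the spectral radius\<close>

text \<open>Over the complex numbers \<open>p\<close> is a product of linear factors, and each
  contributes at least \<open>e\<close> at \<open>z\<close>.\<close>

lemma monic_poly_lower_bound:
  fixes p :: "complex poly"
  assumes "lead_coeff p = 1" and far: "\<And>w. poly p w = 0 \<Longrightarrow> e \<le> cmod (z - w)" and "0 \<le> e"
  shows "e ^ degree p \<le> cmod (poly p z)"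
proof -
  obtain root where root: "(\<Prod>i<degree p. [:- root i, 1:]) = p"
    using complex_poly_decompose'[of p] assms(1) by auto
  have p: "poly p x = (\<Prod>i<degree p. x - root i)" for x
    by (subst root[symmetric]) (simp add: poly_prod)
  have "e ^ degree p = (\<Prod>i<degree p. e)" by simp
  also have "\<dots> \<le> (\<Prod>i<degree p. cmod (z - root i))"
    by (rule prod_mono) (use assms far p in auto)
  finally show ?thesis by (simp add: p prod_norm)
qed

text \<open>A crude bound from the 1-norm of an eigenvector; it keeps the eigenvalues of a
  convergent sequence of matrices bounded.\<close>

lemma cmod_eigenvalue_le_sum:
  assumes "z \<in> eigenvalues X"
  shows "cmod z \<le> (\<Sum>i\<in>UNIV. \<Sum>j\<in>UNIV. \<bar>X $ i $ j\<bar>)"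
proof -
  obtain v where v: "v \<noteq> 0" "map_matrix complex_of_real X *v v = z *s v"
    using assms unfolding eigenvalues_def by blast
  define s where "s = (\<Sum>j\<in>UNIV. cmod (v $ j))"
  have le: "cmod (v $ j) \<le> s" for j
    unfolding s_def by (rule member_le_sum) auto
  obtain k where "v $ k \<noteq> 0" using v(1) by (auto simp: vec_eq_iff)
  then have "s > 0" using le[of k] by (smt (verit) zero_less_norm_iff)
  have "cmod z * s = (\<Sum>i\<in>UNIV. cmod ((z *s v) $ i))"
    by (simp add: s_def sum_distrib_left norm_mult)
  also have "\<dots> = (\<Sum>i\<in>UNIV. cmod (\<Sum>j\<in>UNIV. complex_of_real (X $ i $ j) * v $ j))"
    by (simp add: v(2)[symmetric] matrix_vector_mult_def)
  also have "\<dots> \<le> (\<Sum>i\<in>UNIV. \<Sum>j\<in>UNIV. \<bar>X $ i $ j\<bar> * s)"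
    by (intro sum_mono sum_norm_le) (simp add: norm_mult mult_left_mono le)
  also have "\<dots> = (\<Sum>i\<in>UNIV. \<Sum>j\<in>UNIV. \<bar>X $ i $ j\<bar>) * s"
    by (simp add: sum_distrib_right)
  finally show ?thesis using \<open>s > 0\<close> by simp
qed

lemma tendsto_char_polynomial:
  assumes "(X \<longlongrightarrow> L) F" "(z \<longlongrightarrow> w) F"
  shows "((\<lambda>k. poly (char_polynomial (X k)) (z k)) \<longlongrightarrow> poly (char_polynomial L) w) F"
  unfolding poly_char_polynomial det_def vector_minus_component nth_map_matrix
  by (intro tendsto_intros tendsto_vec_nth assms(1))
    (auto simp: mat_def intro!: tendsto_vec_lambda assms(2))

text \<open>
  Lower semicontinuity comes from the bound above: if no eigenvalue of \<open>X k\<close> is near an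
  eigenvalue \<open>z\<close> of \<open>L\<close>, the monic characteristic polynomial of \<open>X k\<close> cannot be small at \<open>z\<close>.
  Upper semicontinuity holds because a limit point of eigenvalues is an eigenvalue.
\<close>

lemma spec_radius_sequentially:
  fixes X :: "nat \<Rightarrow> real ^ 'n ^ 'n"
  assumes X: "X \<longlonglongrightarrow> L"
  shows "(\<lambda>k. spec_radius (X k)) \<longlonglongrightarrow> spec_radius L"
proof (rule order_tendstoI)
  fix a assume a: "a < spec_radius L"
  obtain z where z: "z \<in> eigenvalues L" "cmod z = spec_radius L" by (rule spec_radius_attained)
  \<comment> \<open>An eigenvalue closer than \<open>e\<close> to \<open>z\<close> has modulus above
    \<open>a\<close>. If there were none, the monic bound would give at least
    \<open>e ^ CARD('n)\<close> at \<open>z\<close>.\<close>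
  define e where "e = spec_radius L - a"
  have e: "e > 0" using a by (simp add: e_def)
  have "(\<lambda>k. cmod (poly (char_polynomial (X k)) z)) \<longlonglongrightarrow> cmod (poly (char_polynomial L) z)"
    by (intro tendsto_norm tendsto_char_polynomial X tendsto_const)
  moreover have "cmod (poly (char_polynomial L) z) < e ^ CARD('n)"
    using z e by (simp add: eigenvalues_eq_roots)
  ultimately have "\<forall>\<^sub>F k in sequentially. cmod (poly (char_polynomial (X k)) z) < e ^ CARD('n)"
    by (rule order_tendstoD)
  then show "\<forall>\<^sub>F k in sequentially. a < spec_radius (X k)"
  proof eventually_elim
    case (elim k)
    then obtain w where w: "w \<in> eigenvalues (X k)" "cmod (z - w) < e"
      using monic_poly_lower_bound[OF lead_coeff_char_polynomial, of "X k" e z] e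
      by (force simp: degree_char_polynomial eigenvalues_eq_roots)
    have "cmod z \<le> cmod (z - w) + cmod w" by (metis norm_triangle_sub add.commute)
    then show ?case using w z cmod_le_spec_radius[OF w(1)] by (simp add: e_def)
  qed
next
  fix a assume a: "spec_radius L < a"
  show "\<forall>\<^sub>F k in sequentially. spec_radius (X k) < a"
  proof (rule ccontr)
    assume "\<not> ?thesis"
    then obtain r :: "nat \<Rightarrow> nat" where r: "strict_mono r" "\<And>k. a \<le> spec_radius (X (r k))"
      using not_eventually_sequentiallyD by (metis not_less)
    have "\<exists>z. z \<in> eigenvalues (X (r k)) \<and> a \<le> cmod z" for k
      using r(2)[of k] spec_radius_attained by metis
    then obtain z where z: "\<And>k. z k \<in> eigenvalues (X (r k))" "\<And>k. a \<le> cmod (z k)" by metis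
    define b where "b k = (\<Sum>i\<in>UNIV. \<Sum>j\<in>UNIV. \<bar>X (r k) $ i $ j\<bar>)" for k
    have Xr: "(\<lambda>k. X (r k)) \<longlonglongrightarrow> L"
      using LIMSEQ_subseq_LIMSEQ[OF X r(1)] by (simp add: o_def)
    have "b \<longlonglongrightarrow> (\<Sum>i\<in>UNIV. \<Sum>j\<in>UNIV. \<bar>L $ i $ j\<bar>)"
      unfolding b_def by (intro tendsto_intros tendsto_vec_nth Xr)
    then obtain B where B: "\<And>k. \<bar>b k\<bar> \<le> B"
      using convergent_imp_Bseq[of b] by (auto simp: convergent_def Bseq_def)
    have "cmod (z k) \<le> B" for k
      using cmod_eigenvalue_le_sum[OF z(1), of k] B[of k] by (simp add: b_def)
    then have "bounded (range z)" by (auto simp: bounded_iff)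
    then obtain w s where s: "strict_mono s" "(z \<circ> s) \<longlonglongrightarrow> w"
      using bounded_imp_convergent_subsequence by blast
    have "(\<lambda>k. poly (char_polynomial (X (r (s k)))) (z (s k))) \<longlonglongrightarrow> poly (char_polynomial L) w"
      using LIMSEQ_subseq_LIMSEQ[OF Xr s(1)] s(2)
      by (intro tendsto_char_polynomial) (simp_all add: o_def)
    moreover have "poly (char_polynomial (X (r (s k)))) (z (s k)) = 0" for k
      using z(1) by (auto simp: eigenvalues_eq_roots)
    ultimately have "poly (char_polynomial L) w = 0" by (simp add: LIMSEQ_const_iff)
    then have "cmod w \<le> spec_radius L"
      by (intro cmod_le_spec_radius) (simp add: eigenvalues_eq_roots)
    moreover have "a \<le> cmod w"
      using tendsto_norm[OF s(2)] z(2) by (intro LIMSEQ_le_const) auto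
    ultimately show False using a by simp
  qed
qed

text \<open>Sequential continuity is continuity here, which covers limits along
  \<open>at_right 0\<close>.\<close>

lemma tendsto_spec_radius:
  assumes "(X \<longlongrightarrow> L) F"
  shows "((\<lambda>k. spec_radius (X k)) \<longlongrightarrow> spec_radius L) F"
proof -
  have "isCont spec_radius L"
    by (simp add: continuous_at_sequentially o_def spec_radius_sequentially)
  then show ?thesis using assms by (rule isCont_tendsto_compose)
qed

section \<open>Nonnegative matrices\<close>

lemma nonneg_matrix_iff: "0 \<le> (X :: real ^ 'n ^ 'm) \<longleftrightarrow> (\<forall>i j. 0 \<le> X $ i $ j)"
  by (simp add: less_eq_vec_def)

lemma nonneg_matrix_vector_mono:
  fixes X :: "real ^ 'n ^ 'm"
  assumes "0 \<le> X" "u \<le> v"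
  shows "X *v u \<le> X *v v"
  using assms
  by (auto simp: less_eq_vec_def matrix_vector_mult_def intro!: sum_mono mult_left_mono)

lemma matrix_vector_mono_left:
  fixes X Y :: "real ^ 'n ^ 'm"
  assumes "X \<le> Y" "0 \<le> u"
  shows "X *v u \<le> Y *v u"
  using assms
  by (auto simp: less_eq_vec_def matrix_vector_mult_def intro!: sum_mono mult_right_mono)

section \<open>Subinvariant vectors and Perron-Frobenius bounds\<close>

lemma cmod_eigenvector_subinvariant:
  assumes "0 \<le> X" "z \<in> eigenvalues X"
  obtains u where "0 \<le> u" "u \<noteq> 0" "cmod z *\<^sub>R u \<le> X *v u"
proof -
  obtain v where v: "v \<noteq> 0" "map_matrix complex_of_real X *v v = z *s v"
    using assms unfolding eigenvalues_def by blast
  show ?thesis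
  \<comment> \<open>Take entrywise moduli in the eigenvector equation: the triangle inequality
    applies and the entries of \<open>X\<close> are their own moduli.\<close>
  proof (rule that[of "\<chi> i. cmod (v $ i)"])
    show "0 \<le> (\<chi> i. cmod (v $ i))" by (simp add: less_eq_vec_def)
    show "(\<chi> i. cmod (v $ i)) \<noteq> 0" using v(1) by (auto simp: vec_eq_iff)
    have "cmod z * cmod (v $ i) \<le> (\<Sum>j\<in>UNIV. X $ i $ j * cmod (v $ j))" for i
    proof -
      have "cmod z * cmod (v $ i) = cmod ((z *s v) $ i)" by (simp add: norm_mult)
      also have "\<dots> = cmod (\<Sum>j\<in>UNIV. complex_of_real (X $ i $ j) * v $ j)"
        by (simp add: v(2)[symmetric] matrix_vector_mult_def)
      also have "\<dots> \<le> (\<Sum>j\<in>UNIV. X $ i $ j * cmod (v $ j))"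
        using assms(1) by (intro sum_norm_le) (simp add: norm_mult nonneg_matrix_iff)
      finally show ?thesis .
    qed
    then show "cmod z *\<^sub>R (\<chi> i. cmod (v $ i)) \<le> X *v (\<chi> i. cmod (v $ i))"
      by (simp add: less_eq_vec_def matrix_vector_mult_def)
  qed
qed

lemma real_eigenvalueI:
  assumes "X *v y = s *\<^sub>R y" "y \<noteq> (0 :: real ^ 'n)"
  shows "complex_of_real s \<in> eigenvalues X"
proof -
  let ?v = "\<chi> i. complex_of_real (y $ i)"
  have "(\<Sum>j\<in>UNIV. X $ i $ j * y $ j) = s * y $ i" for i
    using assms(1) by (simp add: vec_eq_iff matrix_vector_mult_def)
  then have "(\<Sum>j\<in>UNIV. complex_of_real (X $ i $ j) * complex_of_real (y $ j))
      = complex_of_real s * complex_of_real (y $ i)" for i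
    by (simp flip: of_real_mult of_real_sum)
  then have "map_matrix complex_of_real X *v ?v = complex_of_real s *s ?v"
    by (simp add: vec_eq_iff matrix_vector_mult_def)
  moreover have "?v \<noteq> 0" using assms(2) by (auto simp: vec_eq_iff)
  ultimately show ?thesis unfolding eigenvalues_def by blast
qed

text \<open>Brouwer's theorem for the normalised action of \<open>W\<close> on the standard simplex.\<close>

lemma positive_matrix_eigenvector:
  fixes W :: "real ^ 'n ^ 'n"
  assumes pos: "\<And>i j. 0 < W $ i $ j"
  obtains y s where "\<And>i. 0 < y $ i" "0 < s" "W *v y = s *\<^sub>R y"
proof -
  define S where "S = {x :: real ^ 'n. (\<forall>i. 0 \<le> x $ i) \<and> (\<Sum>i\<in>UNIV. x $ i) = 1}"
  define c where "c x = (\<Sum>i\<in>UNIV. (W *v x) $ i)" for x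
  have Wpos: "0 < (W *v x) $ i" if x: "x \<in> S" for x i
  proof -
    have "(\<Sum>i\<in>UNIV. x $ i) \<noteq> 0" using x by (simp add: S_def)
    then have "\<exists>k. x $ k \<noteq> 0" by (meson sum.neutral)
    then obtain k where "0 < x $ k" using x by (auto simp: S_def less_le)
    then show ?thesis using pos x
      unfolding matrix_vector_mult_def S_def
      by (auto intro!: sum_pos2[of _ k] simp: less_imp_le)
  qed
  have cpos: "0 < c x" if "x \<in> S" for x
    unfolding c_def by (rule sum_pos) (use Wpos[OF that] in auto)
  have "closed S"
    unfolding S_def Collect_conj_eq Collect_all_eq
    by (intro closed_Int closed_INT ballI closed_Collect_le closed_Collect_eq continuous_intros)
  moreover have "bounded S"
  proof -
    have "norm x \<le> 1" if "x \<in> S" for x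
      using norm_le_l1_cart[of x] that by (simp add: S_def)
    then show ?thesis by (auto simp: bounded_iff)
  qed
  ultimately have "compact S" by (simp add: compact_eq_bounded_closed)
  moreover have "convex S"
    by (auto simp: convex_def S_def sum.distrib simp flip: sum_distrib_left)
  moreover have "axis undefined 1 \<in> S" by (auto simp: S_def axis_def)
  then have "S \<noteq> {}" by blast
  moreover have "continuous_on S (\<lambda>x. (1 / c x) *\<^sub>R (W *v x))"
    unfolding c_def
    by (intro continuous_intros matrix_vector_mult_linear_continuous_on)
      (use cpos in \<open>force simp: c_def\<close>)
  moreover have "(\<lambda>x. (1 / c x) *\<^sub>R (W *v x)) \<in> S \<rightarrow> S"
  proof
    fix x assume x: "x \<in> S"
    show "(1 / c x) *\<^sub>R (W *v x) \<in> S"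
      using Wpos[OF x] cpos[OF x]
      by (auto simp: S_def less_imp_le c_def simp flip: sum_divide_distrib)
  qed
  ultimately obtain y where y: "y \<in> S" "(1 / c y) *\<^sub>R (W *v y) = y"
    by (rule brouwer)
  have "W *v y = c y *\<^sub>R ((1 / c y) *\<^sub>R (W *v y))" using cpos[OF y(1)] by simp
  then have W: "W *v y = c y *\<^sub>R y" by (simp only: y(2))
  \<comment> \<open>The simplex gives only nonnegativity; strictness comes from
    \<open>W *v y\<close> being positive and a positive multiple of \<open>y\<close>.\<close>
  have "0 < y $ i" for i
    using Wpos[OF y(1), of i] cpos[OF y(1)] by (simp add: W zero_less_mult_iff)
  then show ?thesis using that cpos[OF y(1)] W by blast
qed

text \<open>Pair the inequality with a positive left eigenvector of \<open>W\<close>.\<close>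

lemma subinvariant_le_spec_radius_pos:
  fixes W :: "real ^ 'n ^ 'n"
  assumes pos: "\<And>i j. 0 < W $ i $ j" and u: "0 \<le> u" "u \<noteq> 0" "t *\<^sub>R u \<le> W *v u"
  shows "t \<le> spec_radius W"
proof -
  obtain y s where y: "\<And>i. 0 < y $ i" "0 < s" "transpose W *v y = s *\<^sub>R y"
    using positive_matrix_eigenvector[of "transpose W"] pos by (auto simp: transpose_def)
  have u0: "0 \<le> u $ i" for i using u(1) by (simp add: less_eq_vec_def)
  obtain k where "0 < u $ k" using u(2) u0 by (auto simp: vec_eq_iff less_le)
  then have uy: "0 < u \<bullet> y"
    unfolding inner_vec_def
    by (intro sum_pos2[of _ k]) (auto simp: y(1) u0 less_imp_le)
  have "t * (u \<bullet> y) = (t *\<^sub>R u) \<bullet> y" by simp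
  also have "\<dots> \<le> (W *v u) \<bullet> y"
    unfolding inner_vec_def using u(3) y(1)
    by (intro sum_mono) (auto simp: less_eq_vec_def less_imp_le intro!: mult_right_mono)
  also have "\<dots> = u \<bullet> (transpose W *v y)"
    by (metis dot_lmul_matrix inner_commute transpose_matrix_vector)
  also have "\<dots> = s * (u \<bullet> y)" unfolding y(3) by simp
  finally have "t \<le> s" using uy by simp
  moreover have "y \<noteq> 0" using y(1) by (metis less_irrefl zero_index)
  then have "complex_of_real s \<in> eigenvalues W"
    using real_eigenvalueI[OF y(3)] by (simp add: eigenvalues_transpose)
  then have "s \<le> spec_radius W" using cmod_le_spec_radius y(2) by fastforce
  ultimately show ?thesis by simp
qed

text \<open>Perturb \<open>W\<close> to positive matrices. Since \<open>u\<close> is nonnegative,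
  enlarging entries preserves the inequality, and continuity of the spectral radius removes the
  perturbation.\<close>

lemma subinvariant_le_spec_radius:
  fixes W :: "real ^ 'n ^ 'n"
  assumes W: "0 \<le> W" and u: "0 \<le> u" "u \<noteq> 0" "t *\<^sub>R u \<le> W *v u"
  shows "t \<le> spec_radius W"
proof -
  \<comment> \<open>the numeral \<open>1\<close> is the all-ones matrix, so \<open>X k\<close> is entrywise positive\<close>
  define X where "X k = W + inverse (real (Suc k)) *\<^sub>R 1" for k
  have "X \<longlonglongrightarrow> W + 0 *\<^sub>R 1"
    unfolding X_def by (intro tendsto_intros LIMSEQ_inverse_real_of_nat)
  then have "(\<lambda>k. spec_radius (X k)) \<longlonglongrightarrow> spec_radius W"
    using spec_radius_sequentially[of X W] by simp
  moreover have "t \<le> spec_radius (X k)" for k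
  proof (rule subinvariant_le_spec_radius_pos[OF _ u(1,2)])
    show "0 < X k $ i $ j" for i j
      using W by (simp add: X_def nonneg_matrix_iff add_nonneg_pos)
    have "W \<le> X k" by (simp add: X_def less_eq_vec_def)
    then show "t *\<^sub>R u \<le> X k *v u"
      using u matrix_vector_mono_left order_trans by blast
  qed
  ultimately show ?thesis by (intro LIMSEQ_le_const) auto
qed

text \<open>The moduli of a dominant eigenvector of \<open>X\<close> are subinvariant for
  \<open>X\<close>, hence for the larger \<open>Y\<close>.\<close>

lemma spec_radius_mono:
  fixes X Y :: "real ^ 'n ^ 'n"
  assumes "0 \<le> X" "X \<le> Y"
  shows "spec_radius X \<le> spec_radius Y"
proof -
  obtain z where z: "z \<in> eigenvalues X" "cmod z = spec_radius X" by (rule spec_radius_attained)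
  obtain u where u: "0 \<le> u" "u \<noteq> 0" "cmod z *\<^sub>R u \<le> X *v u"
    using cmod_eigenvector_subinvariant[OF assms(1) z(1)] .
  have "cmod z *\<^sub>R u \<le> Y *v u" using u assms(2) matrix_vector_mono_left order_trans by blast
  then show ?thesis using subinvariant_le_spec_radius[of Y u] u z assms by (metis order_trans)
qed

lemma spec_radius_less_1:
  fixes W G :: "real ^ 'n ^ 'n"
  assumes W: "0 \<le> W" and G: "0 \<le> G" and WG: "G = W + W ** G"
  shows "spec_radius W < 1"
proof (rule ccontr)
  assume "\<not> ?thesis"
  then obtain z where z: "z \<in> eigenvalues W" "1 \<le> cmod z"
    by (metis spec_radius_attained not_less)
  obtain u where u: "0 \<le> u" "u \<noteq> 0" "cmod z *\<^sub>R u \<le> W *v u"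
    using cmod_eigenvector_subinvariant[OF W z(1)] .
  have "1 *\<^sub>R u \<le> cmod z *\<^sub>R u"
    using z(2) u(1) by (intro scaleR_right_mono) auto
  then have Wu: "u \<le> W *v u" using u(3) by simp
  \<comment> \<open>Each use of \<open>G = W + W ** G\<close> adds one copy of \<open>u\<close>: the
    summand \<open>W *v u\<close> dominates \<open>u\<close>, and \<open>W\<close> does not shrink
    the copies already collected.\<close>
  have Gu: "real k *\<^sub>R u \<le> G *v u" for k
  proof (induction k)
    case 0
    show ?case using nonneg_matrix_vector_mono[OF G u(1)] by simp
  next
    case (Suc k)
    have "real k *\<^sub>R u \<le> real k *\<^sub>R (W *v u)"
      using Wu by (auto simp: less_eq_vec_def intro: mult_left_mono)
    also have "\<dots> = W *v (real k *\<^sub>R u)" by (simp add: matrix_vector_mult_scaleR)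
    also have "\<dots> \<le> W *v (G *v u)" by (rule nonneg_matrix_vector_mono[OF W Suc])
    finally have "u + real k *\<^sub>R u \<le> W *v u + W *v (G *v u)" by (intro add_mono Wu)
    also have "\<dots> = G *v u"
      by (subst (2) WG) (simp add: matrix_vector_mult_add_rdistrib matrix_vector_mul_assoc)
    finally show ?case by (simp add: scaleR_add_left)
  qed
  obtain i where i: "0 < u $ i" using u(1,2) by (auto simp: vec_eq_iff less_eq_vec_def less_le)
  obtain k where "(G *v u) $ i < real k * u $ i" using reals_Archimedean3[OF i] by blast
  moreover have "real k * u $ i \<le> (G *v u) $ i" using Gu[of k] by (simp add: less_eq_vec_def)
  ultimately show False by simp
qed

section \<open>Proper splittings\<close>

text \<open>The difference between \<open>x\<close> and its image under
  \<open>moore_penrose A ** A\<close> lies in the null space of \<open>A\<close>, hence in that of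
  \<open>M\<close>.\<close>

lemma moore_penrose_kernel:
  assumes "{x. A *v x = 0} \<subseteq> {x. M *v x = 0}"
  shows "M ** moore_penrose A ** A = M"
proof -
  have "A *v (moore_penrose A *v (A *v x) - x) = 0" for x
    using is_moore_penrose_moore_penrose[of A]
    by (simp add: is_moore_penrose_def matrix_vector_mult_diff_distrib matrix_vector_mul_assoc
        matrix_mul_assoc)
  then have "M *v (moore_penrose A *v (A *v x) - x) = 0" for x using assms by blast
  then show ?thesis
    by (simp add: matrix_eq matrix_vector_mult_diff_distrib flip: matrix_vector_mul_assoc)
qed

lemma moore_penrose_range:
  assumes "range ((*v) M) \<subseteq> range ((*v) A)"
  shows "A ** moore_penrose A ** M = M"
proof -
  have "A *v (moore_penrose A *v (M *v x)) = M *v x" for x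
  proof -
    obtain y where y: "M *v x = A *v y" using assms by blast
    show ?thesis
      using is_moore_penrose_moore_penrose[of A]
      by (simp add: y is_moore_penrose_def matrix_vector_mul_assoc matrix_mul_assoc)
  qed
  then show ?thesis by (simp add: matrix_eq flip: matrix_vector_mul_assoc)
qed

text \<open>Transposing \<open>Q ** P = P\<close> gives \<open>P ** Q = P\<close>, while
  \<open>P ** Q\<close> is also \<open>Q\<close>.\<close>

lemma symmetric_absorbing_eq:
  fixes P Q :: "real ^ 'n ^ 'n"
  assumes "transpose P = P" "transpose Q = Q" "P ** Q = Q" "Q ** P = P"
  shows "P = Q"
  by (metis assms matrix_transpose_mul)

text \<open>Equal ranges and null spaces make the projectors of \<open>A\<close> and
  \<open>M\<close> coincide. Hence \<open>?m ** (M - A) ** ?a = ?a - ?m\<close>, and multiplying by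
  \<open>N\<close> on the right gives the identity.\<close>

lemma proper_splitting_resolvent:
  fixes A M N :: "real ^ 'n ^ 'm"
  assumes "proper_splitting A M N"
  defines "W \<equiv> moore_penrose M ** N" and "G \<equiv> moore_penrose A ** N"
  shows "G = W + W ** G"
proof -
  let ?a = "moore_penrose A" and ?m = "moore_penrose M"
  have N: "N = M - A" and rng: "range ((*v) A) = range ((*v) M)"
    and ker: "{x. A *v x = 0} = {x. M *v x = 0}"
    using assms(1) by (auto simp: proper_splitting_def)
  have a: "?a ** A ** ?a = ?a" "transpose (A ** ?a) = A ** ?a" "transpose (?a ** A) = ?a ** A"
    and m: "?m ** M ** ?m = ?m" "transpose (M ** ?m) = M ** ?m" "transpose (?m ** M) = ?m ** M"
    using is_moore_penrose_moore_penrose[of A] is_moore_penrose_moore_penrose[of M]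
    by (auto simp: is_moore_penrose_def)
  have "A ** ?a = M ** ?m"
  proof (rule symmetric_absorbing_eq[OF a(2) m(2)])
    show "A ** ?a ** (M ** ?m) = M ** ?m" "M ** ?m ** (A ** ?a) = A ** ?a"
      using moore_penrose_range[of M A] moore_penrose_range[of A M] rng
      by (simp_all add: matrix_mul_assoc)
  qed
  moreover have "?a ** A = ?m ** M"
  proof (rule symmetric_absorbing_eq[OF a(3) m(3)])
    have "M ** ?a ** A = M" "A ** ?m ** M = A"
      using moore_penrose_kernel[of A M] moore_penrose_kernel[of M A] ker by simp_all
    then have "?m ** M ** (?a ** A) = ?m ** M" "?a ** A ** (?m ** M) = ?a ** A"
      by (simp_all flip: matrix_mul_assoc)
    \<comment> \<open>The null spaces give the products in the opposite order; transposing swaps the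
      symmetric factors.\<close>
    then show "?a ** A ** (?m ** M) = ?m ** M" "?m ** M ** (?a ** A) = ?a ** A"
      by (metis a(3) m(3) matrix_transpose_mul)+
  qed
  ultimately have "?m ** A ** ?a = ?m" "?m ** M ** ?a = ?a"
    using a(1) m(1) by (metis matrix_mul_assoc)+
  then have "?m *v (A *v (?a *v x)) = ?m *v x" "?m *v (M *v (?a *v x)) = ?a *v x" for x
    by (simp_all add: matrix_vector_mul_assoc matrix_mul_assoc)
  then have "?m *v (N *v (?a *v x)) = ?a *v x - ?m *v x" for x
    by (simp add: N matrix_vector_mult_diff_distrib matrix_vector_mult_diff_rdistrib)
  then have "W ** G = G - W"
    by (simp add: matrix_eq W_def G_def matrix_vector_mult_diff_rdistrib
        flip: matrix_vector_mul_assoc)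
  then show ?thesis by simp
qed

section \<open>The limit of the regularised splittings\<close>

theorem theorem3p7:
  fixes A M N :: "real ^ 'n ^ 'm"
    and M' N' :: "real \<Rightarrow> real ^ 'n ^ 'n"
    and K L :: "real ^ 'n ^ 'n"
  assumes "weak_proper_splitting_first A M N"
    and "0 \<le> moore_penrose A ** N"
    and "\<And>l. l > 0 \<Longrightarrow> weak_splitting_second (regularized_gram A l) (M' l) (N' l)"
    and "((\<lambda>l. N' l ** matrix_inv (regularized_gram A l)) \<longlongrightarrow> K) (at_right 0)"
    and "0 \<le> K"
    and "((\<lambda>l. N' l ** matrix_inv (M' l)) \<longlongrightarrow> L) (at_right 0)"
    and "L \<le> moore_penrose M ** N"
  shows "\<exists>r. ((\<lambda>l. spec_radius (matrix_inv (M' l) ** N' l)) \<longlongrightarrow> r) (at_right 0)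
             \<and> r \<le> spec_radius (moore_penrose M ** N)
             \<and> spec_radius (moore_penrose M ** N) < 1"
\<comment> \<open>The limit \<open>r\<close> will be \<open>spec_radius L\<close>.\<close>
proof (intro exI conjI)
  have ev: "\<forall>\<^sub>F l in at_right 0. invertible (M' l) \<and> 0 \<le> N' l ** matrix_inv (M' l)"
    using eventually_at_right_less[of "0::real"]
    by eventually_elim (use assms(3) in \<open>auto simp: weak_splitting_second_def\<close>)
  have "0 \<le> L $ i $ j" for i j
  proof (rule tendsto_lowerbound)
    show "((\<lambda>l. (N' l ** matrix_inv (M' l)) $ i $ j) \<longlongrightarrow> L $ i $ j) (at_right 0)"
      by (intro tendsto_vec_nth assms(6))
    show "\<forall>\<^sub>F l in at_right 0. 0 \<le> (N' l ** matrix_inv (M' l)) $ i $ j"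
      using ev by eventually_elim (simp add: nonneg_matrix_iff)
  qed simp
  then have "0 \<le> L" by (simp add: nonneg_matrix_iff)
  then show "spec_radius L \<le> spec_radius (moore_penrose M ** N)"
    by (rule spec_radius_mono[OF _ assms(7)])
  show "spec_radius (moore_penrose M ** N) < 1"
    using assms(1,2) spec_radius_less_1 proper_splitting_resolvent
    unfolding weak_proper_splitting_first_def by blast
  \<comment> \<open>Convergence is assumed for \<open>N' l ** matrix_inv (M' l)\<close>; similarity
    transfers its spectral radius to the other order of the factors.\<close>
  have "\<forall>\<^sub>F l in at_right 0.
      spec_radius (N' l ** matrix_inv (M' l)) = spec_radius (matrix_inv (M' l) ** N' l)"
    using ev by eventually_elim (simp add: spec_radius_matrix_inv_commute)
  then show "((\<lambda>l. spec_radius (matrix_inv (M' l) ** N' l)) \<longlongrightarrow> spec_radius L) (at_right 0)"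
    by (rule Lim_transform_eventually[OF tendsto_spec_radius[OF assms(6)]])
qed

end
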